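(* There is an algorithm $\mathcal{A}$ such that for every input transition system $(\mathit{Init},\delta,\mathit{Bad})$ over $n$ Boolean variables and every $k\in\mathbb{N}$, if the system admits an inductive invariant $I$ that can be expressed as a decision tree of size $m$, and $I$ is both backwards $k$-fenced and forwards $k$-fenced, then $\mathcal{A}(\mathit{Init},\delta,\mathit{Bad},k)$ converges to an inductive invariant in $O(m^2)$ inductiveness checks, $O(m^2\cdot n^3)$ $k$-BMC checks, and $O(m^2\cdot n^3)$ time.
   Context: Transition systems. $\Sigma=\{p_1,\dots,p_n\}$ is a finite set of Boolean variables; a state is a valuation of $\Sigma$; a formula over $\Sigma$ is identified with the set of states satisfying it, and $\varphi\Longrightarrow\psi$ means that $\varphi\to\psi$ is valid. A transition system is a triple $(\mathit{Init},\delta,\mathit{Bad})$ with $\mathit{Init},\mathit{Bad}$ formulas over $\Sigma$ and $\delta$ a formula over $\Sigma\uplus\Sigma'$ ($\Sigma'$ a primed copy), describing pairs (pre-state, post-state). Standing assumptions: $\mathit{Init}\not\equiv\mathit{false}$, $\mathit{Bad}\not\equiv\mathit{true},\mathit{false}$, $\mathit{Init}\Longrightarrow\neg\mathit{Bad}$. An inductive invariant is a formula $I$ over $\Sigma$ with (i) $\mathit{Init}\Longrightarrow I$, (ii) $I\wedge\delta\Longrightarrow I'$, (iii) $I\Longrightarrow\neg\mathit{Bad}$, where $I'$ is $I$ with variables primed. $\delta^{\le k}(S)$ is the set of states reachable from some state in $S$ in at most $k$ steps of $\delta$; $(\delta^{-1})^{\le k}(\mathit{Bad})$ is the set of states from which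 some state of $\mathit{Bad}$ is reachable in at most $k$ steps. Two states are neighbors if they differ in exactly one variable. $\partial^+(I)=\{\sigma\models I : \sigma\text{ has a neighbor }\not\models I\}$ and $\partial^-(I)=\{\sigma\not\models I : \sigma \text{ has a neighbor } \models I\}$. An inductive invariant $I$ is forwards $k$-fenced if $\partial^+(I)\subseteq\delta^{\le k}(\mathit{Init})$, and backwards $k$-fenced if $\partial^-(I)\subseteq(\delta^{-1})^{\le k}(\mathit{Bad})$. A decision tree is a binary tree in which every internal node is labeled by a variable and every leaf by true/false; a state $\sigma$ satisfies the formula it expresses if the path from the root that turns left when $\sigma$ assigns false to the variable labeling the node and right otherwise reaches a leaf labeled true. The size of a decision tree is its number of leaves. Complexity measure. The algorithm does not know $I$. It may perform inductiveness checks (deciding whether a candidate is an inductive invariant, and obtaining a counterexample if not; a counterexample to (ii) is a pair $(\sigma,\sigma')\models \varphi\wedge\delta\wedge\neg\varphi'$) and $k$-BMC checks (deciding whether $\delta^{\le k}(\psi)\cap\mathit{Bad}=\emptyset$ or whether $\delta^{\le k}(\mathit{Init})\cap\psi=\emptyset$ for a given $\psi$). Time counts each such check (SAT oracle call) as one step. *)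

theory Defs
  imports "HOL-Library.FuncSet"
begin

section \<open>Formulas and transition systems\<close>

datatype (vars: 'v) fm =
    FTrue | FFalse | FVar 'v | FNot "'v fm" | FAnd "'v fm" "'v fm" | FOr "'v fm" "'v fm"

primrec sat :: "('v \<Rightarrow> bool) \<Rightarrow> 'v fm \<Rightarrow> bool" where
  "sat \<sigma> FTrue = True"
| "sat \<sigma> FFalse = False"
| "sat \<sigma> (FVar x) = \<sigma> x"
| "sat \<sigma> (FNot f) = (\<not> sat \<sigma> f)"
| "sat \<sigma> (FAnd f g) = (sat \<sigma> f \<and> sat \<sigma> g)"
| "sat \<sigma> (FOr f g) = (sat \<sigma> f \<or> sat \<sigma> g)"

text \<open>The \<open>n\<close> Boolean variables are the numbers below \<open>n\<close>; a state is an extensional valuation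
  of them, so that equal valuations are equal functions.\<close>

type_synonym state = "nat \<Rightarrow> bool"

definition states :: "nat \<Rightarrow> state set" where
  "states n = {..<n} \<rightarrow>\<^sub>E UNIV"

definition models :: "nat \<Rightarrow> nat fm \<Rightarrow> state set" where
  "models n f = {\<sigma> \<in> states n. sat \<sigma> f}"

text \<open>In the transition formula, \<open>Inl i\<close> is the variable \<open>i\<close> of the pre-state and \<open>Inr i\<close> its
  primed copy, evaluated in the post-state.\<close>

record tsys =
  num_vars :: nat
  init_fm :: "nat fm"
  trans_fm :: "(nat + nat) fm"
  bad_fm :: "nat fm"

abbreviation Init :: "tsys \<Rightarrow> state set" where
  "Init S \<equiv> models (num_vars S) (init_fm S)"

abbreviation Bad :: "tsys \<Rightarrow> state set" where
  "Bad S \<equiv> models (num_vars S) (bad_fm S)"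

definition \<delta> :: "tsys \<Rightarrow> (state \<times> state) set" where
  "\<delta> S = {(\<sigma>, \<sigma>'). \<sigma> \<in> states (num_vars S) \<and> \<sigma>' \<in> states (num_vars S) \<and>
                  sat (case_sum \<sigma> \<sigma>') (trans_fm S)}"

definition transition_system :: "tsys \<Rightarrow> bool" where
  "transition_system S \<longleftrightarrow>
     vars (init_fm S) \<subseteq> {..<num_vars S} \<and>
     vars (trans_fm S) \<subseteq> {..<num_vars S} <+> {..<num_vars S} \<and>
     vars (bad_fm S) \<subseteq> {..<num_vars S} \<and>
     Init S \<noteq> {} \<and> Bad S \<noteq> {} \<and> Bad S \<noteq> states (num_vars S) \<and>
     Init S \<inter> Bad S = {}"

definition inductive_invariant :: "tsys \<Rightarrow> nat fm \<Rightarrow> bool" where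
  "inductive_invariant S I \<longleftrightarrow>
     vars I \<subseteq> {..<num_vars S} \<and>
     Init S \<subseteq> models (num_vars S) I \<and>
     (\<forall>(\<sigma>, \<sigma>') \<in> \<delta> S. \<sigma> \<in> models (num_vars S) I \<longrightarrow> \<sigma>' \<in> models (num_vars S) I) \<and>
     models (num_vars S) I \<inter> Bad S = {}"


section \<open>The fence condition\<close>

definition reach_upto :: "nat \<Rightarrow> (state \<times> state) set \<Rightarrow> state set \<Rightarrow> state set" where
  "reach_upto k R A = (\<Union>j\<le>k. (R ^^ j) `` A)"

definition neighbors :: "nat \<Rightarrow> state \<Rightarrow> state \<Rightarrow> bool" where
  "neighbors n \<sigma> \<tau> \<longleftrightarrow> card {i. i < n \<and> \<sigma> i \<noteq> \<tau> i} = 1"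

definition inner_boundary :: "nat \<Rightarrow> nat fm \<Rightarrow> state set" where
  "inner_boundary n I =
     {\<sigma> \<in> states n. sat \<sigma> I \<and> (\<exists>\<tau> \<in> states n. neighbors n \<sigma> \<tau> \<and> \<not> sat \<tau> I)}"

definition outer_boundary :: "nat \<Rightarrow> nat fm \<Rightarrow> state set" where
  "outer_boundary n I =
     {\<sigma> \<in> states n. \<not> sat \<sigma> I \<and> (\<exists>\<tau> \<in> states n. neighbors n \<sigma> \<tau> \<and> sat \<tau> I)}"

definition forwards_fenced :: "tsys \<Rightarrow> nat \<Rightarrow> nat fm \<Rightarrow> bool" where
  "forwards_fenced S k I \<longleftrightarrow>
     inner_boundary (num_vars S) I \<subseteq> reach_upto k (\<delta> S) (Init S)"

definition backwards_fenced :: "tsys \<Rightarrow> nat \<Rightarrow> nat fm \<Rightarrow> bool" where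
  "backwards_fenced S k I \<longleftrightarrow>
     outer_boundary (num_vars S) I \<subseteq> reach_upto k ((\<delta> S)\<inverse>) (Bad S)"


section \<open>Decision trees\<close>

datatype (dt_vars: 'v) dtree = Leaf bool | Node 'v "'v dtree" "'v dtree"

primrec dt_sat :: "('v \<Rightarrow> bool) \<Rightarrow> 'v dtree \<Rightarrow> bool" where
  "dt_sat \<sigma> (Leaf b) = b"
| "dt_sat \<sigma> (Node x l r) = (if \<sigma> x then dt_sat \<sigma> r else dt_sat \<sigma> l)"

primrec leaves :: "'v dtree \<Rightarrow> nat" where
  "leaves (Leaf b) = 1"
| "leaves (Node x l r) = leaves l + leaves r"

definition expressed_by_dtree :: "nat \<Rightarrow> nat fm \<Rightarrow> nat \<Rightarrow> bool" where
  "expressed_by_dtree n I m \<longleftrightarrow>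
     (\<exists>t. dt_vars t \<subseteq> {..<n} \<and> leaves t = m \<and> (\<forall>\<sigma> \<in> states n. dt_sat \<sigma> t = sat \<sigma> I))"


section \<open>Inductiveness checks\<close>

datatype answer = Inductive | Cex_Init state | Cex_Step state state | Cex_Bad state

fun valid_answer :: "tsys \<Rightarrow> nat fm \<Rightarrow> answer \<Rightarrow> bool" where
  "valid_answer S f Inductive \<longleftrightarrow> inductive_invariant S f"
| "valid_answer S f (Cex_Init \<sigma>) \<longleftrightarrow> \<sigma> \<in> Init S \<and> \<not> sat \<sigma> f"
| "valid_answer S f (Cex_Step \<sigma> \<sigma>') \<longleftrightarrow> (\<sigma>, \<sigma>') \<in> \<delta> S \<and> sat \<sigma> f \<and> \<not> sat \<sigma>' f"
| "valid_answer S f (Cex_Bad \<sigma>) \<longleftrightarrow> \<sigma> \<in> Bad S \<and> sat \<sigma> f"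

text \<open>Nothing is assumed about which counterexample is reported. The checker sees the index of the
  query besides the formula: it may answer a repeated query differently, so quantifying over all
  checkers covers every (adaptive) choice of counterexamples during a run.\<close>

type_synonym ind_checker = "nat \<Rightarrow> nat fm \<Rightarrow> answer"

definition valid_checker :: "tsys \<Rightarrow> ind_checker \<Rightarrow> bool" where
  "valid_checker S chk \<longleftrightarrow>
     (\<forall>j f. vars f \<subseteq> {..<num_vars S} \<longrightarrow> valid_answer S f (chk j f))"


section \<open>Algorithms\<close>

text \<open>An algorithm is one fixed program, for all numbers of variables and all transition systems,
  of a while language with numbers, arrays of numbers and formulas. Its only access to the
  transition system is through the three checks.

  Time is unit cost: each executed assignment, test and check takes one step. Expressions belong to
  the program text, hence have constant size; there is no multiplication, which keeps unit-cost
  arithmetic reasonable. Formulas are built by reference, sharing subformulas, so one constructor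
  is one step; a formula can be submitted to a check, but not evaluated or inspected.\<close>

type_synonym name = string

datatype aexp = Lit nat | NumVar name | Elem name aexp | Plus aexp aexp | Minus aexp aexp

datatype bexp = Less aexp aexp | Equal aexp aexp | BNot bexp | BAnd bexp bexp

datatype fexp =
    ETrue | EFalse | EVar aexp \<comment> \<open>the propositional variable with this index\<close>
  | EReg name | ENot fexp | EAnd fexp fexp | EOr fexp fexp

datatype com =
    Skip
  | SetNum name aexp
  | SetElem name aexp aexp
  | SetFm name fexp
  | Ind_Check name name name fexp
  | Bmc_Init name fexp
  | Bmc_Bad name fexp
  | Seq com com
  | Cond bexp com com
  | While bexp com

record store =
  num :: "name \<Rightarrow> nat"
  arr :: "name \<Rightarrow> nat \<Rightarrow> nat"
  frm :: "name \<Rightarrow> nat fm"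
  ind_checks :: nat
  bmc_checks :: nat
  steps :: nat

primrec aval :: "store \<Rightarrow> aexp \<Rightarrow> nat" where
  "aval s (Lit c) = c"
| "aval s (NumVar x) = num s x"
| "aval s (Elem a e) = arr s a (aval s e)"
| "aval s (Plus e1 e2) = aval s e1 + aval s e2"
| "aval s (Minus e1 e2) = aval s e1 - aval s e2"

primrec bval :: "store \<Rightarrow> bexp \<Rightarrow> bool" where
  "bval s (Less e1 e2) = (aval s e1 < aval s e2)"
| "bval s (Equal e1 e2) = (aval s e1 = aval s e2)"
| "bval s (BNot b) = (\<not> bval s b)"
| "bval s (BAnd b1 b2) = (bval s b1 \<and> bval s b2)"

primrec fval :: "store \<Rightarrow> fexp \<Rightarrow> nat fm" where
  "fval s ETrue = FTrue"
| "fval s EFalse = FFalse"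
| "fval s (EVar e) = FVar (aval s e)"
| "fval s (EReg x) = frm s x"
| "fval s (ENot f) = FNot (fval s f)"
| "fval s (EAnd f g) = FAnd (fval s f) (fval s g)"
| "fval s (EOr f g) = FOr (fval s f) (fval s g)"

definition tick :: "store \<Rightarrow> store" where
  "tick s = s\<lparr>steps := steps s + 1\<rparr>"

definition set_num :: "name \<Rightarrow> nat \<Rightarrow> store \<Rightarrow> store" where
  "set_num x v s = s\<lparr>num := (num s)(x := v)\<rparr>"

definition set_elem :: "name \<Rightarrow> nat \<Rightarrow> nat \<Rightarrow> store \<Rightarrow> store" where
  "set_elem a i v s = s\<lparr>arr := (arr s)(a := (arr s a)(i := v))\<rparr>"

definition set_frm :: "name \<Rightarrow> nat fm \<Rightarrow> store \<Rightarrow> store" where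
  "set_frm x f s = s\<lparr>frm := (frm s)(x := f)\<rparr>"

definition set_state :: "nat \<Rightarrow> name \<Rightarrow> state \<Rightarrow> store \<Rightarrow> store" where
  "set_state n a \<sigma> s =
     s\<lparr>arr := (arr s)(a := (\<lambda>i. if i < n then of_bool (\<sigma> i) else arr s a i))\<rparr>"

text \<open>\<open>Ind_Check r a a' f\<close> stores the kind of the answer in \<open>r\<close> and the bits of the
  counterexample in the arrays \<open>a\<close> (and \<open>a'\<close> for the post-state of a step).\<close>

fun store_answer :: "nat \<Rightarrow> name \<Rightarrow> name \<Rightarrow> name \<Rightarrow> answer \<Rightarrow> store \<Rightarrow> store" where
  "store_answer n r a a' Inductive s = set_num r 0 s"
| "store_answer n r a a' (Cex_Init \<sigma>) s = set_num r 1 (set_state n a \<sigma> s)"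
| "store_answer n r a a' (Cex_Step \<sigma> \<sigma>') s = set_num r 2 (set_state n a' \<sigma>' (set_state n a \<sigma> s))"
| "store_answer n r a a' (Cex_Bad \<sigma>) s = set_num r 3 (set_state n a \<sigma> s)"

definition count_ind :: "store \<Rightarrow> store" where
  "count_ind s = s\<lparr>ind_checks := ind_checks s + 1\<rparr>"

definition count_bmc :: "store \<Rightarrow> store" where
  "count_bmc s = s\<lparr>bmc_checks := bmc_checks s + 1\<rparr>"

text \<open>Checks are only available for formulas over the variables of the system: a program that
  submits any other formula has no terminating execution. A BMC check stores \<open>0\<close> if the
  intersection is empty and \<open>1\<close> otherwise.\<close>

inductive exec :: "tsys \<Rightarrow> nat \<Rightarrow> ind_checker \<Rightarrow> com \<Rightarrow> store \<Rightarrow> store \<Rightarrow> bool"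
  for S :: tsys and k :: nat and chk :: ind_checker where
  Skip: "exec S k chk Skip s (tick s)"
| SetNum: "exec S k chk (SetNum x e) s (tick (set_num x (aval s e) s))"
| SetElem: "exec S k chk (SetElem a i e) s (tick (set_elem a (aval s i) (aval s e) s))"
| SetFm: "exec S k chk (SetFm x f) s (tick (set_frm x (fval s f) s))"
| Ind_Check: "vars (fval s f) \<subseteq> {..<num_vars S} \<Longrightarrow>
    exec S k chk (Ind_Check r a a' f) s
      (tick (count_ind (store_answer (num_vars S) r a a' (chk (ind_checks s) (fval s f)) s)))"
| Bmc_Init: "vars (fval s f) \<subseteq> {..<num_vars S} \<Longrightarrow>
    exec S k chk (Bmc_Init r f) s
      (tick (count_bmc (set_num r
        (of_bool (reach_upto k (\<delta> S) (Init S) \<inter> models (num_vars S) (fval s f) \<noteq> {})) s)))"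
| Bmc_Bad: "vars (fval s f) \<subseteq> {..<num_vars S} \<Longrightarrow>
    exec S k chk (Bmc_Bad r f) s
      (tick (count_bmc (set_num r
        (of_bool (reach_upto k (\<delta> S) (models (num_vars S) (fval s f)) \<inter> Bad S \<noteq> {})) s)))"
| Seq: "exec S k chk c1 s s' \<Longrightarrow> exec S k chk c2 s' s'' \<Longrightarrow> exec S k chk (Seq c1 c2) s s''"
| Cond_True: "bval s b \<Longrightarrow> exec S k chk c1 (tick s) s' \<Longrightarrow> exec S k chk (Cond b c1 c2) s s'"
| Cond_False: "\<not> bval s b \<Longrightarrow> exec S k chk c2 (tick s) s' \<Longrightarrow> exec S k chk (Cond b c1 c2) s s'"
| While_False: "\<not> bval s b \<Longrightarrow> exec S k chk (While b c) s (tick s)"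
| While_True: "bval s b \<Longrightarrow> exec S k chk c (tick s) s' \<Longrightarrow> exec S k chk (While b c) s' s'' \<Longrightarrow>
    exec S k chk (While b c) s s''"

definition start_store :: "nat \<Rightarrow> nat \<Rightarrow> store" where
  "start_store n k =
     \<lparr>num = (\<lambda>x. 0)(''n'' := n, ''k'' := k), arr = (\<lambda>a i. 0), frm = (\<lambda>x. FTrue),
      ind_checks = 0, bmc_checks = 0, steps = 0\<rparr>"

abbreviation output_fm :: "store \<Rightarrow> nat fm" where
  "output_fm s \<equiv> frm s ''out''"

text \<open>For a given checker a program has at most one final store, so the existence of a final store
  with some property says that the run terminates and ends with that property.\<close>

inductive_cases exec_SkipE: "exec S k chk Skip s t"
inductive_cases exec_SetNumE: "exec S k chk (SetNum x e) s t"
inductive_cases exec_SetElemE: "exec S k chk (SetElem a i e) s t"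
inductive_cases exec_SetFmE: "exec S k chk (SetFm x f) s t"
inductive_cases exec_Ind_CheckE: "exec S k chk (Ind_Check r a a' f) s t"
inductive_cases exec_Bmc_InitE: "exec S k chk (Bmc_Init r f) s t"
inductive_cases exec_Bmc_BadE: "exec S k chk (Bmc_Bad r f) s t"
inductive_cases exec_SeqE: "exec S k chk (Seq c1 c2) s t"
inductive_cases exec_CondE: "exec S k chk (Cond b c1 c2) s t"
inductive_cases exec_WhileE: "exec S k chk (While b c) s t"

lemma exec_deterministic:
  "exec S k chk c s s1 \<Longrightarrow> exec S k chk c s s2 \<Longrightarrow> s1 = s2"
proof (induction arbitrary: s2 rule: exec.induct)
  case (Skip s)
  then show ?case by (elim exec_SkipE) simp
next
  case (SetNum x e s)
  then show ?case by (elim exec_SetNumE) simp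
next
  case (SetElem a i e s)
  then show ?case by (elim exec_SetElemE) simp
next
  case (SetFm x f s)
  then show ?case by (elim exec_SetFmE) simp
next
  case (Ind_Check s f r a a')
  from Ind_Check(2) show ?case by (rule exec_Ind_CheckE) simp
next
  case (Bmc_Init s f r)
  from Bmc_Init(2) show ?case by (rule exec_Bmc_InitE) simp
next
  case (Bmc_Bad s f r)
  from Bmc_Bad(2) show ?case by (rule exec_Bmc_BadE) simp
next
  case (Seq c1 s s' c2 s'')
  from Seq.prems show ?case by (rule exec_SeqE) (use Seq.IH in blast)
next
  case (Cond_True b s c1 s' c2)
  from Cond_True.prems show ?case by (rule exec_CondE) (use Cond_True in blast)+
next
  case (Cond_False b s c2 s' c1)
  from Cond_False.prems show ?case by (rule exec_CondE) (use Cond_False in blast)+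
next
  case (While_False b s c)
  from While_False.prems show ?case by (rule exec_WhileE) (use While_False in blast)+
next
  case (While_True b s c s' s'')
  from While_True.prems show ?case by (rule exec_WhileE) (use While_True in blast)+
qed

lemma ex_valid_checker: "\<exists>chk. valid_checker S chk"
proof -
  have "\<exists>a. valid_answer S f a" if "vars f \<subseteq> {..<num_vars S}" for f
  proof (rule ccontr)
    assume "\<nexists>a. valid_answer S f a"
    then have *: "\<not> valid_answer S f a" for a
      by blast
    have "sat \<sigma> f" if "\<sigma> \<in> Init S" for \<sigma>
      using *[of "Cex_Init \<sigma>"] that by simp
    moreover have "sat \<sigma>' f" if "(\<sigma>, \<sigma>') \<in> \<delta> S" "sat \<sigma> f" for \<sigma> \<sigma>'
      using *[of "Cex_Step \<sigma> \<sigma>'"] that by simp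
    moreover have "\<not> sat \<sigma> f" if "\<sigma> \<in> Bad S" for \<sigma>
      using *[of "Cex_Bad \<sigma>"] that by simp
    ultimately have "inductive_invariant S f"
      using that unfolding inductive_invariant_def models_def by (auto simp: \<delta>_def)
    then show False
      using *[of Inductive] by simp
  qed
  then have "valid_checker S (\<lambda>j f. SOME a. valid_answer S f a)"
    unfolding valid_checker_def by (auto intro: someI_ex)
  then show ?thesis by blast
qed

end

theory Submission
  imports Defs
begin

text \<open>Bshouty's monotone theory. For a state \<open>a\<close> outside the invariant \<open>I\<close>, order the states by
  \<open>y \<le> x\<close> iff \<open>y\<close> lies between \<open>a\<close> and \<open>x\<close>, and let the hull of \<open>I\<close> at \<open>a\<close> be the upward closure of
  \<open>I\<close>. A set that is closed downwards contains, with each of its states, a path of neighbors to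
  \<open>a\<close>. If it meets \<open>I\<close>, it therefore meets the inner boundary of \<open>I\<close>, and so by the forwards fence
  a single BMC check from \<open>Init\<close> decides whether it is disjoint from \<open>I\<close>. Hence the minimal
  elements of \<open>I\<close> are found one after the other, each with \<open>n\<close> BMC checks that greedily fix variables
  to their value in \<open>a\<close>, and one more check tells when the hull is complete.

  The candidate is the conjunction of the hulls learnt so far. As it contains \<open>I\<close>, every
  counterexample to its inductiveness yields a state outside \<open>I\<close>, whose hull comes next. Each leaf of
  the decision tree is a subcube, thus closed under betweenness. Therefore two minimal elements for
  the same \<open>a\<close> never share a leaf, and neither do two of the states \<open>a\<close>: there are at most \<open>m\<close> hulls,
  each with at most \<open>m\<close> minimal elements.\<close>

section \<open>Betweenness and the leaves of a decision tree\<close>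

text \<open>The first argument is the base point of the order, the second is the one in the middle.
  For Boolean values, \<open>y\<close> lies in the smallest subcube containing \<open>a\<close> and
  \<open>x\<close>.\<close>

definition between :: "('v \<Rightarrow> 'b) \<Rightarrow> ('v \<Rightarrow> 'b) \<Rightarrow> ('v \<Rightarrow> 'b) \<Rightarrow> bool" where
  "between a y x \<longleftrightarrow> (\<forall>j. y j = a j \<or> y j = x j)"

lemma between_right: "between a x x"
  by (simp add: between_def)

lemma between_trans: "between a u y \<Longrightarrow> between a y x \<Longrightarrow> between a u x"
  unfolding between_def by metis

lemma between_states: "between a y x \<Longrightarrow> a \<in> states n \<Longrightarrow> x \<in> states n \<Longrightarrow> y \<in> states n"
  unfolding between_def states_def PiE_iff extensional_def by (auto; metis)

lemma states_eqI:
  assumes "x \<in> states n" "y \<in> states n" "\<And>j. j < n \<Longrightarrow> x j = y j"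
  shows "x = y"
  using assms unfolding states_def by (auto intro: PiE_ext)

text \<open>There are only two values, so states that both differ from \<open>a\<close> at
  \<open>j\<close> agree there; outside the \<open>n\<close> variables all states agree. In this
  form the condition on \<open>x\<close> is a conjunction of literals, as built by
  \<open>minimize\<close>.\<close>

lemma between_iff:
  fixes a u x :: state
  assumes "a \<in> states n" "u \<in> states n" "x \<in> states n"
  shows "between a u x \<longleftrightarrow> (\<forall>j<n. u j \<noteq> a j \<longrightarrow> x j \<noteq> a j)"
proof -
  have "u j = a j" if "\<not> j < n" for j
    using assms that unfolding states_def by (auto simp: PiE_iff extensional_def)
  then show ?thesis
    unfolding between_def by metis
qed

text \<open>Numbers the leaves from left to right, so that injectivity of this number on a set
  bounds the size of the set by \<open>leaves t\<close>.\<close>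

primrec leaf_index :: "('v \<Rightarrow> bool) \<Rightarrow> 'v dtree \<Rightarrow> nat" where
  "leaf_index \<sigma> (Leaf b) = 0"
| "leaf_index \<sigma> (Node x l r) = (if \<sigma> x then leaves l + leaf_index \<sigma> r else leaf_index \<sigma> l)"

lemma leaf_index_less: "leaf_index \<sigma> t < leaves t"
  by (induction t) auto

lemma leaves_pos: "0 < leaves t"
  by (induction t) auto

text \<open>The tests on the path to the common leaf have the same outcome for \<sigma> and \<tau>,
  and \<rho> takes one of their values at each variable. Equal numbers put both into the same
  subtree, because numbers from the left subtree stay below \<open>leaves l\<close>.\<close>

lemma leaf_index_between:
  "leaf_index \<sigma> t = leaf_index \<tau> t \<Longrightarrow> between \<sigma> \<rho> \<tau> \<Longrightarrow> leaf_index \<rho> t = leaf_index \<sigma> t"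
proof (induction t)
  case (Node x l r)
  have "\<rho> x = \<sigma> x \<or> \<rho> x = \<tau> x"
    using Node.prems(2) by (simp add: between_def)
  then show ?case
    using Node leaf_index_less[of \<sigma> l] leaf_index_less[of \<tau> l] by (auto split: if_splits)
qed simp

lemma dt_sat_leaf_index: "leaf_index \<sigma> t = leaf_index \<tau> t \<Longrightarrow> dt_sat \<sigma> t = dt_sat \<tau> t"
proof (induction t)
  case (Node x l r)
  then show ?case
    using leaf_index_less[of \<sigma> l] leaf_index_less[of \<tau> l] by (auto split: if_splits)
qed simp

lemma card_le_leaves:
  assumes "inj_on (\<lambda>\<sigma>. leaf_index \<sigma> t) A"
  shows "finite A" "card A \<le> leaves t"
proof -
  have sub: "(\<lambda>\<sigma>. leaf_index \<sigma> t) ` A \<subseteq> {..<leaves t}"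
    using leaf_index_less by auto
  then show "finite A"
    using assms finite_imageD finite_subset by blast
  show "card A \<le> leaves t"
    using card_inj_on_le[OF assms sub] by simp
qed

section \<open>The algorithm\<close>

text \<open>\<open>d\<close> describes the states still under consideration, and \<open>l\<close> is
  the literal giving variable \<open>i\<close> its value in \<open>a\<close>. If some state reached
  from \<open>Init\<close> satisfies both, \<open>l\<close> is added to \<open>d\<close>; otherwise
  variable \<open>i\<close> has to differ from \<open>a\<close>, which \<open>t\<close>
  records.\<close>

definition minimize_step :: com where
  "minimize_step =
     Seq (Cond (Equal (Elem ''a'' (NumVar ''i'')) (Lit 1))
           (SetFm ''l'' (EVar (NumVar ''i'')))
           (SetFm ''l'' (ENot (EVar (NumVar ''i'')))))
    (Seq (Bmc_Init ''r'' (EAnd (EReg ''d'') (EReg ''l'')))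
    (Seq (Cond (Equal (NumVar ''r'') (Lit 1))
           (SetFm ''d'' (EAnd (EReg ''d'') (EReg ''l'')))
           (SetFm ''t'' (EAnd (EReg ''t'') (ENot (EReg ''l'')))))
         (SetNum ''i'' (Plus (NumVar ''i'') (Lit 1)))))"

definition minimize :: com where
  "minimize = While (Less (NumVar ''i'') (NumVar ''n'')) minimize_step"

text \<open>\<open>cur\<close> is the disjunction of the terms found so far, and each round searches
  its complement for a further minimal element. The closing check decides whether another round
  follows.\<close>

definition hull_step :: com where
  "hull_step =
     Seq (SetFm ''d'' (ENot (EReg ''cur'')))
    (Seq (SetFm ''t'' ETrue)
    (Seq (SetNum ''i'' (Lit 0))
    (Seq minimize
    (Seq (SetFm ''cur'' (EOr (EReg ''cur'') (EReg ''t'')))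
         (Bmc_Init ''r'' (ENot (EReg ''cur'')))))))"

definition learn_hull :: com where
  "learn_hull =
     Seq (SetFm ''cur'' EFalse)
    (Seq (Bmc_Init ''r'' (ENot (EReg ''cur'')))
         (While (Equal (NumVar ''r'') (Lit 1)) hull_step))"

text \<open>Initially \<open>out\<close> is \<open>FTrue\<close>, the empty conjunction of
  hulls.\<close>

definition infer :: com where
  "infer =
     Seq (Ind_Check ''r'' ''a'' ''b'' (EReg ''out''))
         (While (BNot (Equal (NumVar ''r'') (Lit 0)))
           (Seq learn_hull
           (Seq (SetFm ''out'' (EAnd (EReg ''out'') (EReg ''cur'')))
                (Ind_Check ''r'' ''a'' ''b'' (EReg ''out'')))))"

section \<open>Total correctness\<close>

text \<open>As execution is deterministic, this is the weakest precondition for total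
  correctness.\<close>

definition runs ::
  "tsys \<Rightarrow> nat \<Rightarrow> ind_checker \<Rightarrow> com \<Rightarrow> store \<Rightarrow> (store \<Rightarrow> bool) \<Rightarrow> bool" where
  "runs S k chk c s Q \<longleftrightarrow> (\<exists>s'. exec S k chk c s s' \<and> Q s')"

lemma runs_mono: "runs S k chk c s P \<Longrightarrow> (\<And>s'. P s' \<Longrightarrow> Q s') \<Longrightarrow> runs S k chk c s Q"
  unfolding runs_def by blast

text \<open>Equivalences, so that simplification computes the final store and the cost of loop-free
  code.\<close>

lemma runs_simps:
  "runs S k chk (SetNum x e) s Q \<longleftrightarrow> Q (tick (set_num x (aval s e) s))"
  "runs S k chk (SetFm x f) s Q \<longleftrightarrow> Q (tick (set_frm x (fval s f) s))"
  "runs S k chk (Seq c1 c2) s Q \<longleftrightarrow> runs S k chk c1 s (\<lambda>s'. runs S k chk c2 s' Q)"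
  "runs S k chk (Cond b c1 c2) s Q \<longleftrightarrow> runs S k chk (if bval s b then c1 else c2) (tick s) Q"
  "runs S k chk (Ind_Check r a a' f) s Q \<longleftrightarrow>
     vars (fval s f) \<subseteq> {..<num_vars S} \<and>
     Q (tick (count_ind (store_answer (num_vars S) r a a' (chk (ind_checks s) (fval s f)) s)))"
  "runs S k chk (Bmc_Init r f) s Q \<longleftrightarrow>
     vars (fval s f) \<subseteq> {..<num_vars S} \<and>
     Q (tick (count_bmc (set_num r
        (of_bool (reach_upto k (\<delta> S) (Init S) \<inter> models (num_vars S) (fval s f) \<noteq> {})) s)))"
  unfolding runs_def
  by (blast intro: exec.intros elim: exec_SetNumE exec_SetFmE exec_SeqE exec_Ind_CheckE exec_Bmc_InitE
    | cases "bval s b"; simp; blast intro: exec.intros elim: exec_CondE)+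

text \<open>Well-founded induction on the variant \<open>\<mu>\<close>. Evaluating the test takes a
  step, hence the \<open>tick\<close> before the body and on exit.\<close>

lemma runs_While:
  fixes \<mu> :: "store \<Rightarrow> nat"
  assumes "P s"
    and step: "\<And>s. P s \<Longrightarrow> bval s b \<Longrightarrow> runs S k chk c (tick s) (\<lambda>s'. P s' \<and> \<mu> s' < \<mu> s)"
    and stop: "\<And>s. P s \<Longrightarrow> \<not> bval s b \<Longrightarrow> Q (tick s)"
  shows "runs S k chk (While b c) s Q"
  using \<open>P s\<close>
proof (induction "\<mu> s" arbitrary: s rule: less_induct)
  case less
  show ?case
  proof (cases "bval s b")
    case True
    then obtain s' where "exec S k chk c (tick s) s'" "P s'" "\<mu> s' < \<mu> s"
      using step[OF less.prems] unfolding runs_def by blast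
    moreover from this obtain s'' where "exec S k chk (While b c) s' s''" "Q s''"
      using less.hyps unfolding runs_def by blast
    ultimately show ?thesis
      unfolding runs_def using True exec.While_True by blast
  next
    case False
    then show ?thesis
      unfolding runs_def using stop[OF less.prems] exec.While_False by blast
  qed
qed

lemmas store_simps = tick_def set_num_def set_frm_def set_state_def count_ind_def count_bmc_def

text \<open>What the inner loops leave intact for the outer one. Keeping \<open>arr\<close>
  preserves the stored counterexample.\<close>

definition frame :: "store \<Rightarrow> store \<Rightarrow> bool" where
  "frame s s' \<longleftrightarrow> num s' ''n'' = num s ''n'' \<and> arr s' = arr s \<and> frm s' ''out'' = frm s ''out'' \<and>
     ind_checks s' = ind_checks s"

section \<open>Deciding disjointness from the invariant by bounded reachability\<close>

locale fenced_system =
  fixes S :: tsys and k :: nat and I :: "nat fm" and t :: "nat dtree" and chk :: ind_checker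
  assumes invariant: "inductive_invariant S I"
    and tree: "\<forall>\<sigma> \<in> states (num_vars S). dt_sat \<sigma> t = sat \<sigma> I"
    and fenced: "forwards_fenced S k I"
    and checker: "valid_checker S chk"
begin

abbreviation "n \<equiv> num_vars S"
abbreviation "F \<equiv> models n I"
abbreviation "R \<equiv> reach_upto k (\<delta> S) (Init S)"

lemma F_states: "F \<subseteq> states n"
  by (auto simp: models_def)

lemma R_subset: "R \<subseteq> F"
proof -
  have "\<sigma> \<in> Init S \<Longrightarrow> (\<sigma>, \<tau>) \<in> \<delta> S ^^ j \<Longrightarrow> \<tau> \<in> F" for \<sigma> \<tau> j
    using invariant unfolding inductive_invariant_def
    by (induction j arbitrary: \<tau>) auto
  then show ?thesis
    unfolding reach_upto_def by auto
qed

text \<open>Induction on the Hamming distance from \<open>a\<close>. Moving \<open>z\<close> one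
  coordinate closer to \<open>a\<close> gives a neighbor in \<open>Z\<close>, which by induction is
  outside \<open>F\<close>. If \<open>z\<close> were in \<open>F\<close>, it would be on the inner
  boundary and so in \<open>R\<close> by the forwards fence, contradicting \<open>unreached\<close>.
  At distance zero, \<open>z\<close> is \<open>a\<close>.\<close>

lemma disjoint_if_unreached:
  assumes a: "a \<in> states n" "a \<notin> F"
    and Z: "Z \<subseteq> states n" "\<And>y z. z \<in> Z \<Longrightarrow> between a y z \<Longrightarrow> y \<in> Z"
    and unreached: "R \<inter> Z = {}"
  shows "F \<inter> Z = {}"
proof -
  have "z \<notin> F" if "z \<in> Z" for z
    using that
  proof (induction "card {j. j < n \<and> z j \<noteq> a j}" arbitrary: z rule: less_induct)
    case less
    show ?case
    proof (cases "\<exists>j<n. z j \<noteq> a j")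
      case True
      then obtain j where j: "j < n" "z j \<noteq> a j" by blast
      let ?y = "z(j := a j)"
      have y: "?y \<in> Z"
        by (rule Z(2)[OF less.prems]) (simp add: between_def)
      have "card {i. i < n \<and> ?y i \<noteq> a i} < card {i. i < n \<and> z i \<noteq> a i}"
        by (rule psubset_card_mono) (use j in auto)
      then have "?y \<notin> F"
        using less.hyps y by blast
      moreover have "{i. i < n \<and> z i \<noteq> ?y i} = {j}"
        using j by auto
      then have "neighbors n z ?y"
        unfolding neighbors_def by simp
      ultimately have "z \<in> F \<Longrightarrow> z \<in> inner_boundary n I"
        using y Z(1) unfolding inner_boundary_def models_def by auto
      then show ?thesis
        using fenced unreached less.prems unfolding forwards_fenced_def by blast
    next
      case False
      then have "z = a"
        using less.prems Z(1) a(1) by (intro states_eqI[of _ n]) auto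
      then show ?thesis using a by simp
    qed
  qed
  then show ?thesis by blast
qed

section \<open>Minimal elements, hulls and leaves\<close>

definition minimal :: "state \<Rightarrow> state \<Rightarrow> bool" where
  "minimal a u \<longleftrightarrow> u \<in> F \<and> (\<forall>z \<in> F. between a z u \<longrightarrow> z = u)"

definition hull :: "state \<Rightarrow> state set" where
  "hull a = {x \<in> states n. \<exists>y \<in> F. between a y x}"

lemma F_subset_hull: "F \<subseteq> hull a"
  using F_states unfolding hull_def by (force intro: between_right)

lemma F_leaf_index:
  assumes "\<sigma> \<in> states n" "\<tau> \<in> states n" "leaf_index \<sigma> t = leaf_index \<tau> t"
  shows "\<sigma> \<in> F \<longleftrightarrow> \<tau> \<in> F"
  using assms tree dt_sat_leaf_index unfolding models_def by blast

text \<open>The median \<open>z\<close> of \<open>a\<close>, \<open>u\<close> and \<open>v\<close>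
  is below both \<open>u\<close> and \<open>v\<close> in the order at \<open>a\<close>, and it lies
  between \<open>u\<close> and \<open>v\<close> because states are Boolean. Thus it shares their
  leaf, belongs to \<open>F\<close>, and by minimality equals both.\<close>

lemma minimal_leaf_index:
  assumes "a \<in> states n" "minimal a u" "minimal a v" "leaf_index u t = leaf_index v t"
  shows "u = v"
proof -
  define z where "z = (\<lambda>j. if u j = v j then u j else a j)"
  have uv: "u \<in> states n" "v \<in> states n" "u \<in> F"
    using assms F_states unfolding minimal_def by auto
  have z: "between u z v" "between a z u" "between a z v"
    unfolding z_def between_def by auto
  have "z \<in> F"
    using F_leaf_index leaf_index_between[OF assms(4) z(1)] between_states[OF z(1)] uv by blast
  then have "z = u" "z = v"
    using assms z unfolding minimal_def by auto
  then show ?thesis by simp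
qed

text \<open>A witness \<open>y\<close> in \<open>F\<close> between \<open>a\<close> and
  \<open>x\<close> would share the leaf of \<open>a\<close>, although \<open>a\<close> is outside
  \<open>F\<close>. So the hull at \<open>a\<close> excludes the whole leaf of \<open>a\<close>, and
  later counterexamples fall into other leaves.\<close>

lemma outside_hull_leaf_index:
  assumes "a \<in> states n" "a \<notin> F" "x \<in> hull a"
  shows "leaf_index x t \<noteq> leaf_index a t"
proof
  assume eq: "leaf_index x t = leaf_index a t"
  obtain y where y: "y \<in> F" "between a y x" "x \<in> states n"
    using assms unfolding hull_def by blast
  then have "leaf_index y t = leaf_index a t"
    using leaf_index_between eq by metis
  then show False
    using F_leaf_index assms y F_states by blast
qed

section \<open>Greedy search for a minimal element\<close>

definition encodes :: "state \<Rightarrow> store \<Rightarrow> bool" where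
  "encodes a s \<longleftrightarrow> (\<forall>j<n. arr s ''a'' j = of_bool (a j))"

text \<open>By \<open>down\<close>, each check concerns a set closed towards \<open>a\<close>. A
  negative answer therefore excludes all of \<open>F\<close> and not just the reached states, which
  makes the element found minimal in \<open>F\<close>.\<close>

lemma minimize_correct:
  assumes a: "a \<in> states n" "a \<notin> F"
    and s: "num s ''n'' = n" "encodes a s" "num s ''i'' = 0"
      "frm s ''d'' = FNot (frm s ''cur'')" "frm s ''t'' = FTrue" "vars (frm s ''cur'') \<subseteq> {..<n}"
    and down: "\<And>y z. z \<in> states n \<Longrightarrow> \<not> sat z (frm s ''cur'') \<Longrightarrow> between a y z \<Longrightarrow>
      \<not> sat y (frm s ''cur'')"
    and reached: "R \<inter> models n (FNot (frm s ''cur'')) \<noteq> {}"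
  shows "runs S k chk minimize s (\<lambda>s'. frame s s' \<and> frm s' ''cur'' = frm s ''cur'' \<and>
      vars (frm s' ''t'') \<subseteq> {..<n} \<and> bmc_checks s' = bmc_checks s + n \<and>
      steps s' = steps s + 7 * n + 1 \<and>
      (\<exists>u. minimal a u \<and> \<not> sat u (frm s ''cur'') \<and>
         (\<forall>x \<in> states n. sat x (frm s' ''t'') \<longleftrightarrow> between a u x)))"
proof -
  define c where "c = frm s ''cur''"
  have down: "z \<in> states n \<Longrightarrow> \<not> sat z c \<Longrightarrow> between a y z \<Longrightarrow> \<not> sat y c" for y z
    using down unfolding c_def by blast
  define D where "D G = {x \<in> states n. \<not> sat x c \<and> (\<forall>j \<in> G. x j = a j)}" for G
  have D_disjoint: "F \<inter> D G = {}" if "R \<inter> D G = {}" for G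
  proof (rule disjoint_if_unreached[OF a _ _ that])
    show "y \<in> D G" if "z \<in> D G" "between a y z" for y z
      using that down between_states[OF _ a(1)] unfolding D_def between_def by (auto; metis)
  qed (auto simp: D_def)
  \<comment> \<open>\<open>G\<close> holds the variables fixed to their value in \<open>a\<close>;
    \<open>t\<close> speaks about the rejected ones. The seven steps per variable are the loop test,
    two conditionals with one assignment each, the check and the increment.\<close>
  define P where "P s' \<longleftrightarrow> (\<exists>G. frame s s' \<and> frm s' ''cur'' = c \<and>
      vars (frm s' ''t'') \<subseteq> {..<n} \<and> vars (frm s' ''d'') \<subseteq> {..<n} \<and>
      bmc_checks s' = bmc_checks s + num s' ''i'' \<and>
      steps s' = steps s + 7 * num s' ''i'' \<and> num s' ''i'' \<le> n \<and>
      G \<subseteq> {..<num s' ''i''} \<and> models n (frm s' ''d'') = D G \<and>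
      (\<forall>x. sat x (frm s' ''t'') \<longleftrightarrow> (\<forall>j<num s' ''i''. j \<notin> G \<longrightarrow> x j \<noteq> a j)) \<and>
      R \<inter> D G \<noteq> {} \<and> (\<forall>j<num s' ''i''. j \<notin> G \<longrightarrow> F \<inter> D (insert j G) = {}))" for s'
  show ?thesis
    unfolding minimize_def
  proof (rule runs_While[where P = P and \<mu> = "\<lambda>s. n - num s ''i''"])
    have "models n (FNot c) = D {}"
      by (auto simp: D_def models_def)
    then show "P s"
      unfolding P_def using s reached by (intro exI[of _ "{}"]) (auto simp: frame_def c_def)
  next
    fix s1
    assume "P s1" and "bval s1 (Less (NumVar ''i'') (NumVar ''n''))"
    then obtain G where G: "frame s s1" "frm s1 ''cur'' = c"
      "vars (frm s1 ''t'') \<subseteq> {..<n}" "vars (frm s1 ''d'') \<subseteq> {..<n}"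
      "bmc_checks s1 = bmc_checks s + num s1 ''i''"
      "steps s1 = steps s + 7 * num s1 ''i''"
      "G \<subseteq> {..<num s1 ''i''}" "models n (frm s1 ''d'') = D G"
      "\<And>x. sat x (frm s1 ''t'') \<longleftrightarrow> (\<forall>j<num s1 ''i''. j \<notin> G \<longrightarrow> x j \<noteq> a j)"
      "R \<inter> D G \<noteq> {}" "\<And>j. j<num s1 ''i'' \<Longrightarrow> j \<notin> G \<Longrightarrow> F \<inter> D (insert j G) = {}"
      and i: "num s1 ''i'' < n"
      using s unfolding P_def frame_def by auto
    define i where "i = num s1 ''i''"
    define l where "l = (if a i then FVar i else FNot (FVar i))"
    define d where "d = frm s1 ''d''"
    have arr_a: "arr s1 ''a'' i = of_bool (a i)"
      using G(1) s(2) i unfolding frame_def encodes_def i_def by simp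
    have l: "sat x l \<longleftrightarrow> x i = a i" "vars l \<subseteq> {..<n}" for x
      using i unfolding l_def i_def by auto
    have d: "models n (FAnd d l) = D (insert i G)"
      using G(8) l unfolding d_def D_def models_def by auto
    have body: "runs S k chk minimize_step (tick s1) Q \<longleftrightarrow>
      Q (s1\<lparr>bmc_checks := bmc_checks s1 + 1,
           frm := (if R \<inter> D (insert i G) \<noteq> {}
             then (frm s1)(''l'' := l, ''d'' := FAnd d l)
             else (frm s1)(''l'' := l, ''t'' := FAnd (frm s1 ''t'') (FNot l))),
           num := (num s1)(''r'' := of_bool (R \<inter> D (insert i G) \<noteq> {}), ''i'' := i + 1),
           steps := steps s1 + 7\<rparr>)" for Q
    proof -
      have "vars d \<subseteq> {..<n}" using G(4) d_def by simp
      then show ?thesis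
        using l(2) d arr_a
        by (cases "a i"; cases "R \<inter> D (insert i G) = {}")
          (simp_all add: minimize_step_def runs_simps store_simps l_def i_def[symmetric]
            d_def[symmetric] eval_nat_numeral)
    qed
    show "runs S k chk minimize_step (tick s1) (\<lambda>s2. P s2 \<and> n - num s2 ''i'' < n - num s1 ''i'')"
    proof (cases "R \<inter> D (insert i G) = {}")
      case True
      then have "F \<inter> D (insert i G) = {}"
        by (rule D_disjoint)
      then show ?thesis
        unfolding body P_def using True G l i
        by (intro conjI exI[of _ G]) (auto simp: frame_def i_def[symmetric] less_Suc_eq)
    next
      case False
      define s2 where "s2 = s1\<lparr>bmc_checks := bmc_checks s1 + 1,
        frm := (frm s1)(''l'' := l, ''d'' := FAnd d l),
        num := (num s1)(''r'' := 1, ''i'' := i + 1), steps := steps s1 + 7\<rparr>"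
      have "P s2"
        unfolding P_def
      proof (intro exI[of _ "insert i G"] conjI allI impI)
        show "F \<inter> D (insert j (insert i G)) = {}" if "j < num s2 ''i''" "j \<notin> insert i G" for j
        proof -
          \<comment> \<open>\<open>D\<close> is antitone, so earlier rejections stay justified when
            \<open>G\<close> grows.\<close>
          have "D (insert j (insert i G)) \<subseteq> D (insert j G)"
            unfolding D_def by auto
          moreover have "j < i" "j \<notin> G"
            using that by (auto simp: s2_def)
          ultimately show ?thesis
            using G(11)[of j] unfolding i_def by blast
        qed
        show "sat x (frm s2 ''t'') \<longleftrightarrow> (\<forall>j<num s2 ''i''. j \<notin> insert i G \<longrightarrow> x j \<noteq> a j)" for x
          using G(9)[of x] by (auto simp: s2_def i_def[symmetric] less_Suc_eq)
        show "models n (frm s2 ''d'') = D (insert i G)" "R \<inter> D (insert i G) \<noteq> {}"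
          using d False by (simp_all add: s2_def)
        show "vars (frm s2 ''d'') \<subseteq> {..<n}" "vars (frm s2 ''t'') \<subseteq> {..<n}"
          using G(3,4) l(2) by (simp_all add: s2_def d_def)
        show "insert i G \<subseteq> {..<num s2 ''i''}"
          using G(7) by (auto simp: s2_def i_def[symmetric])
      qed (use G(1,2,5,6) i in \<open>simp_all add: s2_def frame_def i_def[symmetric]\<close>)
      then show ?thesis
        unfolding body using False i by (simp add: s2_def i_def[symmetric])
    qed
  next
    fix s1
    assume "P s1" and "\<not> bval s1 (Less (NumVar ''i'') (NumVar ''n''))"
    then obtain G where G: "frame s s1" "frm s1 ''cur'' = c" "vars (frm s1 ''t'') \<subseteq> {..<n}"
      "bmc_checks s1 = bmc_checks s + num s1 ''i''" "steps s1 = steps s + 7 * num s1 ''i''"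
      "\<forall>x. sat x (frm s1 ''t'') \<longleftrightarrow> (\<forall>j<num s1 ''i''. j \<notin> G \<longrightarrow> x j \<noteq> a j)"
      "R \<inter> D G \<noteq> {}" "\<forall>j<num s1 ''i''. j \<notin> G \<longrightarrow> F \<inter> D (insert j G) = {}"
      "num s1 ''i'' \<le> n" "num s1 ''n'' \<le> num s1 ''i''"
      unfolding P_def by auto
    have i: "num s1 ''i'' = n"
      using G(1,9,10) s(1) by (simp add: frame_def)
    note G = G[unfolded i]
    have fixed: "F \<inter> D (insert j G) = {}" if "j < n" "j \<notin> G" for j
      using G(8) that by blast
    obtain u where u: "u \<in> R" "u \<in> D G"
      using G(7) by blast
    have uF: "u \<in> F" "u \<in> states n"
      using u(1) R_subset F_states by auto
    \<comment> \<open>Any reached state left in \<open>D G\<close> will do: it agrees with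
      \<open>a\<close> on \<open>G\<close>, and agreement at a rejected variable would put it into a
      set already known to miss \<open>F\<close>.\<close>
    have u_G: "u j = a j \<longleftrightarrow> j \<in> G" if "j < n" for j
    proof
      show "j \<in> G" if "u j = a j"
      proof (rule ccontr)
        assume "j \<notin> G"
        moreover have "u \<in> D (insert j G)"
          using u(2) that unfolding D_def by simp
        ultimately show False
          using fixed[of j] \<open>j < n\<close> uF(1) by blast
      qed
    qed (use u(2) in \<open>simp add: D_def\<close>)
    \<comment> \<open>A state \<open>z\<close> of \<open>F\<close> below \<open>u\<close> stays in
      \<open>D G\<close>, so it too differs from \<open>a\<close> at every rejected
      variable.\<close>
    have "z = u" if z: "z \<in> F" "between a z u" for z
    proof (rule states_eqI[of _ n])
      show "z \<in> states n" "u \<in> states n"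
        using z(1) F_states uF by auto
      have "\<not> sat z c"
        using down[OF uF(2) _ z(2)] u(2) unfolding D_def by blast
      moreover have "z j = a j" if "j \<in> G" for j
        using that z(2) u(2) unfolding D_def between_def by force
      ultimately have z_D: "z \<in> D G"
        using z(1) F_states unfolding D_def by blast
      have "z j \<noteq> a j" if "j < n" "j \<notin> G" for j
      proof
        assume "z j = a j"
        then have "z \<in> D (insert j G)"
          using z_D unfolding D_def by simp
        then show False
          using fixed[OF that] z(1) by blast
      qed
      then show "z j = u j" if "j < n" for j
        using z(2) u_G[OF that] that unfolding between_def by metis
    qed
    then have "minimal a u"
      using uF unfolding minimal_def by blast
    moreover have "\<not> sat u c"
      using u(2) unfolding D_def by simp
    moreover have "sat x (frm s1 ''t'') \<longleftrightarrow> between a u x" if "x \<in> states n" for x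
      unfolding spec[OF G(6)] between_iff[OF a(1) uF(2) that] using u_G by auto
    ultimately show "frame s (tick s1) \<and> frm (tick s1) ''cur'' = frm s ''cur'' \<and>
      vars (frm (tick s1) ''t'') \<subseteq> {..<n} \<and> bmc_checks (tick s1) = bmc_checks s + n \<and>
      steps (tick s1) = steps s + 7 * n + 1 \<and>
      (\<exists>u. minimal a u \<and> \<not> sat u (frm s ''cur'') \<and>
         (\<forall>x \<in> states n. sat x (frm (tick s1) ''t'') \<longleftrightarrow> between a u x))"
      using G unfolding c_def[symmetric] by (auto simp: frame_def tick_def)
  qed
qed

section \<open>Learning one hull\<close>

text \<open>The minimal elements found form the set \<open>U\<close> and occupy different leaves,
  which bounds the rounds by \<open>leaves t\<close>. A round costs \<open>7 * n + 1\<close> steps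
  for \<open>minimize\<close> and six more: the loop test, four assignments and a check.\<close>

lemma learn_hull_correct:
  assumes a: "a \<in> states n" "a \<notin> F"
    and s: "num s ''n'' = n" "encodes a s"
  shows "runs S k chk learn_hull s (\<lambda>s'. frame s s' \<and> vars (frm s' ''cur'') \<subseteq> {..<n} \<and>
      bmc_checks s' \<le> bmc_checks s + 1 + leaves t * (n + 1) \<and>
      steps s' \<le> steps s + 3 + leaves t * (7 * n + 7) \<and>
      models n (frm s' ''cur'') = hull a)"
proof -
  define P where "P s' \<longleftrightarrow> (\<exists>U. frame s s' \<and> vars (frm s' ''cur'') \<subseteq> {..<n} \<and>
      inj_on (\<lambda>u. leaf_index u t) U \<and> U \<subseteq> Collect (minimal a) \<and>
      (\<forall>x \<in> states n. sat x (frm s' ''cur'') \<longleftrightarrow> (\<exists>u \<in> U. between a u x)) \<and>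
      num s' ''r'' = of_bool (R \<inter> models n (FNot (frm s' ''cur'')) \<noteq> {}) \<and>
      bmc_checks s' = bmc_checks s + 1 + card U * (n + 1) \<and>
      steps s' = steps s + 2 + card U * (7 * n + 7))" for s'
  \<comment> \<open>\<open>card U\<close> is not a function of the store, but the number of steps is an affine function of it.\<close>
  let ?\<mu> = "\<lambda>s'. steps s + 3 + leaves t * (7 * n + 7) - steps s'"
  \<comment> \<open>\<open>cur\<close> describes a union of upward closed sets, so its complement is
    closed towards \<open>a\<close>.\<close>
  have down: "\<not> sat y (frm s' ''cur'')"
    if "\<forall>x \<in> states n. sat x (frm s' ''cur'') \<longleftrightarrow> (\<exists>u \<in> U. between a u x)"
      "z \<in> states n" "\<not> sat z (frm s' ''cur'')" "between a y z" for s' U y z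
    using that between_states[OF _ a(1)] between_trans by blast
  have while: "runs S k chk (While (Equal (NumVar ''r'') (Lit 1)) hull_step) s0
    (\<lambda>s'. frame s s' \<and> vars (frm s' ''cur'') \<subseteq> {..<n} \<and>
      bmc_checks s' \<le> bmc_checks s + 1 + leaves t * (n + 1) \<and>
      steps s' \<le> steps s + 3 + leaves t * (7 * n + 7) \<and>
      models n (frm s' ''cur'') = hull a)" if "P s0" for s0
  proof (rule runs_While[where P = P and \<mu> = ?\<mu>])
    show "P s0" by (rule that)
  next
    fix s1
    assume "P s1" and r: "bval s1 (Equal (NumVar ''r'') (Lit 1))"
    then obtain U where U: "frame s s1" "vars (frm s1 ''cur'') \<subseteq> {..<n}"
      "inj_on (\<lambda>u. leaf_index u t) U" "U \<subseteq> Collect (minimal a)"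
      "\<forall>x \<in> states n. sat x (frm s1 ''cur'') \<longleftrightarrow> (\<exists>u \<in> U. between a u x)"
      "R \<inter> models n (FNot (frm s1 ''cur'')) \<noteq> {}"
      "bmc_checks s1 = bmc_checks s + 1 + card U * (n + 1)"
      "steps s1 = steps s + 2 + card U * (7 * n + 7)"
      unfolding P_def by (auto simp: of_bool_def split: if_splits)
    define s2 where "s2 = s1\<lparr>frm := (frm s1)(''d'' := FNot (frm s1 ''cur''), ''t'' := FTrue),
      num := (num s1)(''i'' := 0), steps := steps s1 + 4\<rparr>"
    have s2: "frame s1 s2" "frm s2 ''cur'' = frm s1 ''cur''" "bmc_checks s2 = bmc_checks s1"
      "steps s2 = steps s1 + 4"
      by (simp_all add: s2_def frame_def)
    have hull_step: "runs S k chk hull_step (tick s1) Q \<longleftrightarrow>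
      runs S k chk minimize s2 (\<lambda>s'.
        runs S k chk (Seq (SetFm ''cur'' (EOr (EReg ''cur'') (EReg ''t'')))
         (Bmc_Init ''r'' (ENot (EReg ''cur'')))) s' Q)" for Q
      unfolding hull_step_def by (simp add: runs_simps store_simps s2_def eval_nat_numeral)
    show "runs S k chk hull_step (tick s1) (\<lambda>s'. P s' \<and> ?\<mu> s' < ?\<mu> s1)"
      unfolding hull_step
    proof (rule runs_mono[OF minimize_correct[OF a]])
      show "num s2 ''n'' = n" "encodes a s2" "num s2 ''i'' = 0"
        "frm s2 ''d'' = FNot (frm s2 ''cur'')" "frm s2 ''t'' = FTrue"
        "vars (frm s2 ''cur'') \<subseteq> {..<n}" "R \<inter> models n (FNot (frm s2 ''cur'')) \<noteq> {}"
        using s U unfolding s2_def frame_def encodes_def by auto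
      show "\<not> sat y (frm s2 ''cur'')"
        if "z \<in> states n" "\<not> sat z (frm s2 ''cur'')" "between a y z" for y z
        using down[OF U(5)] that s2(2) by simp
    next
      fix s3
      assume s3: "frame s2 s3 \<and> frm s3 ''cur'' = frm s2 ''cur'' \<and>
        vars (frm s3 ''t'') \<subseteq> {..<n} \<and> bmc_checks s3 = bmc_checks s2 + n \<and>
        steps s3 = steps s2 + 7 * n + 1 \<and>
        (\<exists>u. minimal a u \<and> \<not> sat u (frm s2 ''cur'') \<and>
           (\<forall>x \<in> states n. sat x (frm s3 ''t'') \<longleftrightarrow> between a u x))"
      then obtain u where u: "minimal a u" "\<not> sat u (frm s1 ''cur'')"
        "\<And>x. x \<in> states n \<Longrightarrow> sat x (frm s3 ''t'') \<longleftrightarrow> between a u x"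
        using s2(2) by auto
      have "u \<in> states n"
        using u(1) F_states unfolding minimal_def by auto
      then have "u \<notin> U"
        using u(2) U(5) between_right by blast
      moreover have "leaf_index u t \<noteq> leaf_index v t" if "v \<in> U" for v
        using minimal_leaf_index[OF a(1) u(1)] U(4) that \<open>u \<notin> U\<close> by blast
      ultimately have inj: "inj_on (\<lambda>u. leaf_index u t) (insert u U)"
        using U(3) by auto
      have card: "card (insert u U) = card U + 1" "card U < leaves t"
        using \<open>u \<notin> U\<close> card_le_leaves[OF inj] by auto
      have "card U * (7 * n + 7) \<le> leaves t * (7 * n + 7)"
        using card(2) by (intro mult_right_mono) auto
      \<comment> \<open>With truncated subtraction the variant decreases only if it is still
        positive; \<open>card U < leaves t\<close> ensures this.\<close>
      then have mu: "steps s1 < steps s + 3 + leaves t * (7 * n + 7)"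
        unfolding U(8) by linarith
      have inv: "sat x (FOr (frm s3 ''cur'') (frm s3 ''t'')) \<longleftrightarrow>
        (\<exists>v \<in> insert u U. between a v x)" if "x \<in> states n" for x
        using s3 s2(2) u(3) U(5) that by auto
      let ?c = "FOr (frm s3 ''cur'') (frm s3 ''t'')"
      have vars: "vars (FNot ?c) \<subseteq> {..<n}"
        using s3 s2 U(2) by simp
      define s4 where "s4 = s3\<lparr>frm := (frm s3)(''cur'' := ?c),
        num := (num s3)(''r'' := of_bool (R \<inter> models n (FNot ?c) \<noteq> {})),
        bmc_checks := bmc_checks s3 + 1, steps := steps s3 + 2\<rparr>"
      have "P s4"
        unfolding P_def
      proof (intro exI[of _ "insert u U"] conjI)
        show "frame s s4"
          using U(1) s2(1) s3 unfolding s4_def frame_def by simp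
        show "vars (frm s4 ''cur'') \<subseteq> {..<n}"
          using vars by (simp add: s4_def)
        show "insert u U \<subseteq> Collect (minimal a)"
          using u(1) U(4) by simp
        show "bmc_checks s4 = bmc_checks s + 1 + card (insert u U) * (n + 1)"
          using s3 s2(3) U(7) card(1) by (simp add: s4_def)
        show "steps s4 = steps s + 2 + card (insert u U) * (7 * n + 7)"
          using s3 s2(4) U(8) card(1) by (simp add: s4_def)
      qed (use inj inv in \<open>simp_all add: s4_def\<close>)
      moreover have "steps s1 < steps s4"
        using s3 s2(4) by (simp add: s4_def)
      then have "?\<mu> s4 < ?\<mu> s1"
        using mu by (intro diff_less_mono2)
      ultimately show "runs S k chk (Seq (SetFm ''cur'' (EOr (EReg ''cur'') (EReg ''t'')))
         (Bmc_Init ''r'' (ENot (EReg ''cur'')))) s3 (\<lambda>s'. P s' \<and> ?\<mu> s' < ?\<mu> s1)"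
        using vars by (simp add: runs_simps store_simps s4_def)
    qed
  next
    fix s1
    assume "P s1" and r: "\<not> bval s1 (Equal (NumVar ''r'') (Lit 1))"
    then obtain U where U: "frame s s1" "vars (frm s1 ''cur'') \<subseteq> {..<n}"
      "inj_on (\<lambda>u. leaf_index u t) U" "U \<subseteq> Collect (minimal a)"
      "\<forall>x \<in> states n. sat x (frm s1 ''cur'') \<longleftrightarrow> (\<exists>u \<in> U. between a u x)"
      "R \<inter> models n (FNot (frm s1 ''cur'')) = {}"
      "bmc_checks s1 = bmc_checks s + 1 + card U * (n + 1)"
      "steps s1 = steps s + 2 + card U * (7 * n + 7)"
      unfolding P_def by (auto simp: of_bool_def split: if_splits)
    have "F \<inter> models n (FNot (frm s1 ''cur'')) = {}"
    proof (rule disjoint_if_unreached[OF a _ _ U(6)])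
      show "y \<in> models n (FNot (frm s1 ''cur''))"
        if "z \<in> models n (FNot (frm s1 ''cur''))" "between a y z" for y z
        using that down[OF U(5)] between_states[OF _ a(1)] by (auto simp: models_def)
    qed (auto simp: models_def)
    then have "\<exists>u \<in> U. between a u y" if "y \<in> F" for y
      using that U(5) F_states by (auto simp: models_def)
    moreover have "U \<subseteq> F"
      using U(4) unfolding minimal_def by auto
    \<comment> \<open>Every state of \<open>F\<close> lies above an element of \<open>U\<close>, and
      \<open>U\<close> is part of \<open>F\<close>, so both have the same upward closure.\<close>
    ultimately have "models n (frm s1 ''cur'') = hull a"
      using U(5) between_trans unfolding hull_def models_def[of n "frm s1 ''cur''"] by blast
    moreover have "card U * (n + 1) \<le> leaves t * (n + 1)"
      "card U * (7 * n + 7) \<le> leaves t * (7 * n + 7)"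
      using card_le_leaves[OF U(3)] by (simp_all only: mult_le_mono1)
    ultimately show "frame s (tick s1) \<and> vars (frm (tick s1) ''cur'') \<subseteq> {..<n} \<and>
      bmc_checks (tick s1) \<le> bmc_checks s + 1 + leaves t * (n + 1) \<and>
      steps (tick s1) \<le> steps s + 3 + leaves t * (7 * n + 7) \<and>
      models n (frm (tick s1) ''cur'') = hull a"
      using U by (simp add: tick_def frame_def)
  qed
  define s0 where "s0 = s\<lparr>frm := (frm s)(''cur'' := FFalse),
    num := (num s)(''r'' := of_bool (R \<inter> models n (FNot FFalse) \<noteq> {})),
    bmc_checks := bmc_checks s + 1, steps := steps s + 2\<rparr>"
  have "P s0"
    unfolding P_def by (intro exI[of _ "{}"]) (simp add: s0_def frame_def)
  then show ?thesis
    unfolding learn_hull_def using while by (simp add: runs_simps store_simps s0_def)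
qed

section \<open>Counterexamples and the main loop\<close>

text \<open>An initial state cannot refute a candidate containing \<open>F\<close>. In a step
  counterexample the post-state is outside \<open>F\<close>, hence by inductiveness so is the
  pre-state; a bad state is outside \<open>F\<close> by safety. In both cases array
  \<open>''a''\<close> receives a state of the candidate outside \<open>F\<close>.\<close>

lemma answer_correct:
  fixes s :: store and j :: nat
  assumes f: "vars f \<subseteq> {..<n}" "F \<subseteq> models n f"
  defines "s' \<equiv> tick (count_ind (store_answer n ''r'' ''a'' ''b'' (chk j f) s))"
  shows "num s' ''n'' = num s ''n''" "frm s' = frm s" "ind_checks s' = ind_checks s + 1"
    "bmc_checks s' = bmc_checks s" "steps s' = steps s + 1"
    "num s' ''r'' = 0 \<Longrightarrow> inductive_invariant S f"
    "num s' ''r'' \<noteq> 0 \<Longrightarrow> \<exists>a \<in> models n f - F. encodes a s'"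
proof -
  have valid: "valid_answer S f (chk j f)"
    using checker f(1) unfolding valid_checker_def by blast
  have inv: "Init S \<subseteq> F" "\<And>\<sigma> \<sigma>'. (\<sigma>, \<sigma>') \<in> \<delta> S \<Longrightarrow> \<sigma> \<in> F \<Longrightarrow> \<sigma>' \<in> F" "F \<inter> Bad S = {}"
    using invariant unfolding inductive_invariant_def by auto
  show "num s' ''n'' = num s ''n''" "frm s' = frm s" "ind_checks s' = ind_checks s + 1"
    "bmc_checks s' = bmc_checks s" "steps s' = steps s + 1"
    unfolding s'_def by (cases "chk j f"; simp add: store_simps)+
  show "num s' ''r'' = 0 \<Longrightarrow> inductive_invariant S f"
    using valid unfolding s'_def by (cases "chk j f") (simp_all add: store_simps)
  show "\<exists>a \<in> models n f - F. encodes a s'" if r: "num s' ''r'' \<noteq> 0"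
  proof (cases "chk j f")
    case Inductive
    then show ?thesis
      using r unfolding s'_def by (simp add: store_simps)
  next
    case (Cex_Init \<sigma>)
    then have "\<sigma> \<in> Init S" "\<not> sat \<sigma> f"
      using valid by simp_all
    then show ?thesis
      using inv(1) f(2) by (auto simp: models_def)
  next
    case (Cex_Step \<sigma> \<sigma>')
    then have "(\<sigma>, \<sigma>') \<in> \<delta> S" "sat \<sigma> f" "\<not> sat \<sigma>' f"
      using valid by simp_all
    then have "\<sigma> \<in> models n f" "\<sigma> \<notin> F"
      using inv(2) f(2) by (auto simp: models_def \<delta>_def)
    then show ?thesis
      using Cex_Step unfolding s'_def encodes_def by (intro bexI[of _ \<sigma>]) (simp_all add: store_simps)
  next
    case (Cex_Bad \<sigma>)
    then have "\<sigma> \<in> Bad S" "sat \<sigma> f"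
      using valid by simp_all
    then have "\<sigma> \<in> models n f" "\<sigma> \<notin> F"
      using inv(3) by (auto simp: models_def)
    then show ?thesis
      using Cex_Bad unfolding s'_def encodes_def by (intro bexI[of _ \<sigma>]) (simp_all add: store_simps)
  qed
qed

text \<open>\<open>A\<close> collects the states whose hulls have been learnt; they occupy different
  leaves. Beyond its hull, a round costs one inductiveness check. The constant \<open>6\<close>
  consists of three steps in \<open>learn_hull\<close>, the loop test, the update of
  \<open>out\<close> and that check.\<close>

lemma infer_correct:
  fixes M :: nat
  defines "M \<equiv> leaves t"
  shows "runs S k chk infer (start_store n k) (\<lambda>s. inductive_invariant S (output_fm s) \<and>
    ind_checks s \<le> 1 + M \<and> bmc_checks s \<le> M * (1 + M * (n + 1)) \<and>
    steps s \<le> 2 + M * (6 + M * (7 * n + 7)))"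
proof -
  define P where "P s \<longleftrightarrow> (\<exists>A. num s ''n'' = n \<and> vars (output_fm s) \<subseteq> {..<n} \<and>
      A \<subseteq> states n - F \<and> inj_on (\<lambda>a. leaf_index a t) A \<and>
      models n (output_fm s) = {x \<in> states n. \<forall>a \<in> A. x \<in> hull a} \<and>
      (num s ''r'' = 0 \<longrightarrow> inductive_invariant S (output_fm s)) \<and>
      (num s ''r'' \<noteq> 0 \<longrightarrow> (\<exists>a \<in> models n (output_fm s) - F. encodes a s)) \<and>
      ind_checks s = 1 + card A \<and> bmc_checks s \<le> card A * (1 + M * (n + 1)) \<and>
      steps s \<le> 1 + card A * (6 + M * (7 * n + 7)))" for s
  let ?loop = "While (BNot (Equal (NumVar ''r'') (Lit 0)))
    (Seq learn_hull (Seq (SetFm ''out'' (EAnd (EReg ''out'') (EReg ''cur'')))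
      (Ind_Check ''r'' ''a'' ''b'' (EReg ''out''))))"
  have loop: "runs S k chk ?loop s0 (\<lambda>s. inductive_invariant S (output_fm s) \<and>
    ind_checks s \<le> 1 + M \<and> bmc_checks s \<le> M * (1 + M * (n + 1)) \<and>
    steps s \<le> 2 + M * (6 + M * (7 * n + 7)))" if "P s0" for s0
  proof (rule runs_While[where P = P and \<mu> = "\<lambda>s. 2 + M - ind_checks s"])
    show "P s0" by (rule that)
  next
    fix s
    assume "P s" and "bval s (BNot (Equal (NumVar ''r'') (Lit 0)))"
    then obtain A a where A: "num s ''n'' = n" "vars (output_fm s) \<subseteq> {..<n}"
      "A \<subseteq> states n - F" "inj_on (\<lambda>a. leaf_index a t) A"
      "models n (output_fm s) = {x \<in> states n. \<forall>a \<in> A. x \<in> hull a}"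
      "ind_checks s = 1 + card A" "bmc_checks s \<le> card A * (1 + M * (n + 1))"
      "steps s \<le> 1 + card A * (6 + M * (7 * n + 7))"
      and a: "a \<in> models n (output_fm s)" "a \<notin> F" "encodes a s"
      unfolding P_def by auto
    have a_states: "a \<in> states n"
      using a(1) by (simp add: models_def)
    \<comment> \<open>As a state of the candidate, \<open>a\<close> lies in every earlier hull, and
      these avoid the leaves of their base points.\<close>
    have new: "leaf_index a t \<noteq> leaf_index b t" if "b \<in> A" for b
      using outside_hull_leaf_index[of b a] A(3,5) a(1) that by auto
    then have "a \<notin> A"
      by blast
    have inj: "inj_on (\<lambda>a. leaf_index a t) (insert a A)"
      using A(4) new by auto
    have card: "card (insert a A) = card A + 1" "card A < M"
      using \<open>a \<notin> A\<close> card_le_leaves[OF inj] by (auto simp: M_def)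
    show "runs S k chk
      (Seq learn_hull (Seq (SetFm ''out'' (EAnd (EReg ''out'') (EReg ''cur'')))
        (Ind_Check ''r'' ''a'' ''b'' (EReg ''out''))))
      (tick s) (\<lambda>s'. P s' \<and> 2 + M - ind_checks s' < 2 + M - ind_checks s)"
    proof (subst runs_simps(3), rule runs_mono[OF learn_hull_correct[OF a_states a(2)]])
      show "num (tick s) ''n'' = n" "encodes a (tick s)"
        using A(1) a(3) by (simp_all add: tick_def encodes_def)
    next
      fix s1
      assume s1: "frame (tick s) s1 \<and> vars (frm s1 ''cur'') \<subseteq> {..<n} \<and>
        bmc_checks s1 \<le> bmc_checks (tick s) + 1 + leaves t * (n + 1) \<and>
        steps s1 \<le> steps (tick s) + 3 + leaves t * (7 * n + 7) \<and>
        models n (frm s1 ''cur'') = hull a"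
      define g where "g = FAnd (output_fm s) (frm s1 ''cur'')"
      define s2 where "s2 = s1\<lparr>frm := (frm s1)(''out'' := g), steps := steps s1 + 1\<rparr>"
      define s3 where
        "s3 = tick (count_ind (store_answer n ''r'' ''a'' ''b'' (chk (ind_checks s2) g) s2))"
      have out: "frm s1 ''out'' = output_fm s"
        using s1 by (simp add: frame_def tick_def)
      have assign:
        "tick (set_frm ''out'' (fval s1 (EAnd (EReg ''out'') (EReg ''cur''))) s1) = s2"
        and s2_out: "output_fm s2 = g"
        by (simp_all add: s2_def g_def out tick_def set_frm_def)
      have g: "models n g = {x \<in> states n. \<forall>b \<in> insert a A. x \<in> hull b}" "vars g \<subseteq> {..<n}"
        using s1 A(2,5) unfolding g_def models_def by auto
      have "F \<subseteq> models n g"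
        unfolding g(1) using F_states F_subset_hull by blast
      note s3 = answer_correct[OF g(2) this, of "ind_checks s2" s2, folded s3_def]
      have "P s3"
        unfolding P_def
      proof (intro exI[of _ "insert a A"] conjI)
        show "num s3 ''n'' = n"
          using s1 A(1) s3(1) by (simp add: s2_def frame_def tick_def)
        have "output_fm s3 = g"
          using s3(2) by (simp add: s2_def)
        then show "vars (output_fm s3) \<subseteq> {..<n}"
          "models n (output_fm s3) = {x \<in> states n. \<forall>b \<in> insert a A. x \<in> hull b}"
          "num s3 ''r'' = 0 \<longrightarrow> inductive_invariant S (output_fm s3)"
          "num s3 ''r'' \<noteq> 0 \<longrightarrow> (\<exists>b \<in> models n (output_fm s3) - F. encodes b s3)"
          using g s3(6,7) by simp_all
        show "insert a A \<subseteq> states n - F"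
          using a_states a(2) A(3) by simp
        show "ind_checks s3 = 1 + card (insert a A)"
          using s1 s3(3) A(6) card(1) by (simp add: s2_def frame_def tick_def)
        show "bmc_checks s3 \<le> card (insert a A) * (1 + M * (n + 1))"
          using s1 s3(4) A(7) card(1) by (simp add: s2_def tick_def M_def)
        show "steps s3 \<le> 1 + card (insert a A) * (6 + M * (7 * n + 7))"
          using s1 s3(5) A(8) card(1) by (simp add: s2_def tick_def M_def)
      qed (rule inj)
      moreover have "ind_checks s3 = 1 + ind_checks s"
        using s1 s3(3) by (simp add: s2_def frame_def tick_def)
      ultimately show "runs S k chk (Seq (SetFm ''out'' (EAnd (EReg ''out'') (EReg ''cur'')))
        (Ind_Check ''r'' ''a'' ''b'' (EReg ''out''))) s1
        (\<lambda>s'. P s' \<and> 2 + M - ind_checks s' < 2 + M - ind_checks s)"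
        using g(2) A(6) card(2) unfolding runs_simps assign by (simp add: s2_out s3_def[symmetric])
    qed
  next
    fix s
    assume "P s" and "\<not> bval s (BNot (Equal (NumVar ''r'') (Lit 0)))"
    then obtain A where A: "inj_on (\<lambda>a. leaf_index a t) A" "inductive_invariant S (output_fm s)"
      "ind_checks s = 1 + card A" "bmc_checks s \<le> card A * (1 + M * (n + 1))"
      "steps s \<le> 1 + card A * (6 + M * (7 * n + 7))"
      unfolding P_def by auto
    have card: "card A \<le> M"
      using card_le_leaves[OF A(1)] by (simp add: M_def)
    have "bmc_checks s \<le> M * (1 + M * (n + 1))"
      using A(4) mult_le_mono1[OF card] order_trans by blast
    moreover have "steps s \<le> 1 + M * (6 + M * (7 * n + 7))"
      using A(5) mult_le_mono1[OF card, of "6 + M * (7 * n + 7)"] by linarith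
    ultimately show "inductive_invariant S (output_fm (tick s)) \<and> ind_checks (tick s) \<le> 1 + M \<and>
      bmc_checks (tick s) \<le> M * (1 + M * (n + 1)) \<and>
      steps (tick s) \<le> 2 + M * (6 + M * (7 * n + 7))"
      using A card unfolding tick_def by simp
  qed
  define s0 where "s0 = start_store n k"
  define s1 where
    "s1 = tick (count_ind (store_answer n ''r'' ''a'' ''b'' (chk (ind_checks s0) FTrue) s0))"
  have s0: "num s0 ''n'' = n" "output_fm s0 = FTrue" "ind_checks s0 = 0" "bmc_checks s0 = 0"
    "steps s0 = 0"
    by (simp_all add: s0_def start_store_def)
  have "F \<subseteq> models n FTrue"
    by (auto simp: models_def)
  note s1 = answer_correct[OF _ this, of "ind_checks s0" s0, folded s1_def]
  \<comment> \<open>No hull is learnt yet, so \<open>A\<close> is empty and the candidate is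
    \<open>FTrue\<close>.\<close>
  have "P s1"
    unfolding P_def using s1 s0 by (intro exI[of _ "{}"]) (auto simp: models_def)
  then have "runs S k chk ?loop s1 (\<lambda>s. inductive_invariant S (output_fm s) \<and>
    ind_checks s \<le> 1 + M \<and> bmc_checks s \<le> M * (1 + M * (n + 1)) \<and>
    steps s \<le> 2 + M * (6 + M * (7 * n + 7)))"
    by (rule loop)
  then show ?thesis
    unfolding infer_def s0_def[symmetric] by (simp add: runs_simps s0 s1_def)
qed

end

section \<open>Asymptotic bounds\<close>

text \<open>Without variables there is just one state, and it would be both initial and bad.
  Positivity lets \<open>m ^ 2 * n ^ 3\<close> absorb the terms of lower order.\<close>

lemma num_vars_pos:
  assumes "transition_system S"
  shows "0 < num_vars S"
proof (rule ccontr)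
  assume "\<not> 0 < num_vars S"
  then have "states (num_vars S) = {\<lambda>_. undefined}"
    by (simp add: states_def)
  then show False
    using assms unfolding transition_system_def models_def by auto
qed

theorem corollary7p9:
  "\<exists>(A :: com) (C :: nat).
     \<forall>(S :: tsys) (k :: nat) (I :: nat fm) (m :: nat) (chk :: ind_checker).
       transition_system S \<longrightarrow>
       inductive_invariant S I \<longrightarrow>
       expressed_by_dtree (num_vars S) I m \<longrightarrow>
       backwards_fenced S k I \<longrightarrow>
       forwards_fenced S k I \<longrightarrow>
       valid_checker S chk \<longrightarrow>
       (\<exists>s. exec S k chk A (start_store (num_vars S) k) s \<and>
            inductive_invariant S (output_fm s) \<and>
            ind_checks s \<le> C * m ^ 2 \<and>
            bmc_checks s \<le> C * (m ^ 2 * num_vars S ^ 3) \<and>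
            steps s \<le> C * (m ^ 2 * num_vars S ^ 3))"
\<comment> \<open>The constant is \<open>2 + 6 + 7 + 7\<close>, the sum of the coefficients in the
  expanded step bound; it also covers the bounds on both kinds of checks.\<close>
proof (intro exI[of _ infer] exI[of _ 22] allI impI)
  fix S :: tsys and k :: nat and I :: "nat fm" and m :: nat and chk :: ind_checker
  let ?n = "num_vars S"
  assume S: "transition_system S" "inductive_invariant S I" "expressed_by_dtree ?n I m"
    "backwards_fenced S k I" "forwards_fenced S k I" "valid_checker S chk"
  from S(3) obtain t where t: "leaves t = m" "\<forall>\<sigma> \<in> states ?n. dt_sat \<sigma> t = sat \<sigma> I"
    unfolding expressed_by_dtree_def by blast
  interpret fenced_system S k I t chk
    using S t by unfold_locales
  obtain s where s: "exec S k chk infer (start_store ?n k) s" "inductive_invariant S (output_fm s)"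
    "ind_checks s \<le> 1 + m" "bmc_checks s \<le> m * (1 + m * (?n + 1))"
    "steps s \<le> 2 + m * (6 + m * (7 * ?n + 7))"
    using infer_correct unfolding runs_def t(1) by blast
  define q where "q = m ^ 2 * ?n ^ 3"
  have pos: "1 \<le> m" "1 \<le> ?n"
    using leaves_pos[of t] t(1) num_vars_pos[OF S(1)] by auto
  have n: "1 \<le> ?n ^ 3" "?n \<le> ?n ^ 3" and m: "1 \<le> m ^ 2" "m \<le> m ^ 2"
    using pos by (auto intro: self_le_power)
  have q: "1 \<le> q" "m \<le> q" "m ^ 2 \<le> q" "m ^ 2 * ?n \<le> q"
    using mult_le_mono[OF m(1) n(1)] mult_le_mono[OF m(2) n(1)]
      mult_le_mono[OF le_refl n(1)] mult_le_mono[OF le_refl n(2)]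
    unfolding q_def by auto
  have "bmc_checks s \<le> m + m ^ 2 * ?n + m ^ 2" "steps s \<le> 2 + 6 * m + 7 * (m ^ 2 * ?n) + 7 * m ^ 2"
    using s(4,5) by (simp_all add: algebra_simps power2_eq_square)
  then have "ind_checks s \<le> 22 * m ^ 2" "bmc_checks s \<le> 22 * q" "steps s \<le> 22 * q"
    using s(3) m q by linarith+
  then show "\<exists>s. exec S k chk infer (start_store ?n k) s \<and> inductive_invariant S (output_fm s) \<and>
    ind_checks s \<le> 22 * m ^ 2 \<and> bmc_checks s \<le> 22 * (m ^ 2 * ?n ^ 3) \<and>
    steps s \<le> 22 * (m ^ 2 * ?n ^ 3)"
    using s(1,2) unfolding q_def by blast
qed

end
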